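(* Let $M$ be a positive integer and let $a$ and $r$ be nonnegative integers. Put $A_M:=\operatorname{lcm}(1,2,\dots,M)$. Then $$\sum_{N=0}^{\infty} p\bigl(MN-(A_M a+r),\,2M,\,N\bigr)z^{N}=\frac{\mathrm{Num}_e(M,r)}{(1-z^2)\,(z;z)_{2M-1}},$$ where $$\mathrm{Num}_e(M,r)=\sum_{j=1}^M(-1)^{M-j}\,z^{A_M a/j}\, S_j\!\left(z^{\,r+\binom{M-j+1}{2}}\,\frac{(1-z^{2j})\,(z^j;z^j)_{2M-1}}{(z;z)_{2M}}\begin{bmatrix}2M\\ M-j\end{bmatrix}_z\right).$$
   Context: For an indeterminate $x$ and a nonnegative integer $k$, $(x;q)_k:=(1-x)(1-xq)\cdots(1-xq^{k-1})$ with $(x;q)_0:=1$. The Gaussian polynomial ($q$-binomial coefficient) is $\begin{bmatrix}N+m\\ m\end{bmatrix}_q=\frac{(q;q)_{N+m}}{(q;q)_m(q;q)_N}$ for $m,N\ge 0$. For integers $n$ and $m,N\ge0$, $p(n,m,N)$ denotes the number of partitions of $n$ into at most $m$ parts, each part at most $N$; equivalently $p(n,m,N)$ is the coefficient of $q^n$ in $\begin{bmatrix}N+m\\ m\end{bmatrix}_q$ (so it is $0$ for $n<0$ or $n>mN$). For a polynomial $P(z)=\sum_{i=0}^d a_i z^i$ and a positive integer $s$, the $s$-dissection is $(S_sP)(z):=\sum_{i=0}^{\lfloor d/s\rfloor} a_{is}z^i$ (the expression inside $S_j$ above is a polynomial in $z$). *)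

theory Defs
  imports
    "HOL-Library.Multiset"
    "HOL-Computational_Algebra.Computational_Algebra"
    "HOL-Computational_Algebra.Field_as_Ring"
begin

definition qpoch :: "'a::comm_ring_1 \<Rightarrow> 'a \<Rightarrow> nat \<Rightarrow> 'a"
  where "qpoch x q k = (\<Prod>i<k. 1 - x * q ^ i)"

abbreviation pX :: "rat poly"
  where "pX \<equiv> [:0, 1:]"

text \<open>The polynomial division is exact for m \<open>\<le>\<close> n, see \<open>gauss_poly_mult\<close>.\<close>

definition gauss_poly :: "nat \<Rightarrow> nat \<Rightarrow> rat poly"
  where "gauss_poly n m = qpoch pX pX n div (qpoch pX pX m * qpoch pX pX (n - m))"

text \<open>A partition is the multiset of its (positive) parts.\<close>

definition box_partitions :: "int \<Rightarrow> nat \<Rightarrow> nat \<Rightarrow> nat multiset set"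
  where "box_partitions n m N =
    {K. (\<forall>k \<in># K. 1 \<le> k \<and> k \<le> N) \<and> size K \<le> m \<and> int (sum_mset K) = n}"

definition box_partition_count :: "int \<Rightarrow> nat \<Rightarrow> nat \<Rightarrow> nat"
  where "box_partition_count n m N = card (box_partitions n m N)"

definition dissection :: "nat \<Rightarrow> 'a::comm_ring_1 poly \<Rightarrow> 'a poly"
  where "dissection s P = (\<Sum>i\<le>degree P div s. monom (coeff P (i * s)) i)"

definition lcm_upto :: "nat \<Rightarrow> nat"
  where "lcm_upto M = Lcm {1..M}"

text \<open>The argument of the dissection. The polynomial division is exact for \<open>1 \<le> j \<le> M\<close>:
  \<open>fps_of_dissected_poly\<close> identifies it with the rational function in question.\<close>

definition dissected_poly :: "nat \<Rightarrow> nat \<Rightarrow> nat \<Rightarrow> rat poly"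
  where "dissected_poly M r j =
    pX ^ (r + ((M - j + 1) choose 2)) *
    (((1 - pX ^ (2 * j)) * qpoch (pX ^ j) (pX ^ j) (2 * M - 1) * gauss_poly (2 * M) (M - j))
      div qpoch pX pX (2 * M))"

text \<open>The exponent of the prefactor is integral, since j divides \<open>lcm_upto M\<close> for \<open>1 \<le> j \<le> M\<close>.\<close>

definition Num_e :: "nat \<Rightarrow> nat \<Rightarrow> nat \<Rightarrow> rat poly"
  where "Num_e M a r =
    (\<Sum>j = 1..M. (-1) ^ (M - j) * pX ^ (lcm_upto M * a div j) * dissection j (dissected_poly M r j))"


subsection \<open>Exactness of the divisions\<close>

definition cyc :: "nat list \<Rightarrow> rat poly"
  where "cyc xs = (\<Prod>k\<leftarrow>xs. 1 - pX ^ k)"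

lemma cyc_append: "cyc (xs @ ys) = cyc xs * cyc ys"
  by (simp add: cyc_def)

lemma pX_power: "pX ^ k = monom 1 k"
  by (metis monom_altdef mult_1 smult_1_left)

lemma one_minus_pX_power_nz:
  assumes "k > 0" shows "1 - pX ^ k \<noteq> 0"
proof
  assume "1 - pX ^ k = 0"
  then have "coeff (1 - pX ^ k) 0 = 0" by simp
  then show False using assms by (simp add: pX_power)
qed

lemma cyc_nz: "0 \<notin> set xs \<Longrightarrow> cyc xs \<noteq> 0"
proof (induction xs)
  case (Cons k xs)
  then have "1 - pX ^ k \<noteq> 0" by (intro one_minus_pX_power_nz) auto
  then show ?case using Cons by (simp add: cyc_def del: right_minus_eq)
qed (simp add: cyc_def)

lemma not_sq_dvd:
  assumes p: "prime p" and k: "k > 0"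
  shows "\<not> p ^ 2 dvd 1 - pX ^ k"
proof
  assume "p ^ 2 dvd 1 - pX ^ k"
  then obtain c where c: "1 - pX ^ k = p * (p * c)"
    unfolding power2_eq_square mult.assoc dvd_def by blast
  have "pderiv (1 - pX ^ k) = p * pderiv (p * c) + (p * c) * pderiv p"
    unfolding c by (simp add: pderiv_mult)
  also have "\<dots> = p * (pderiv (p * c) + c * pderiv p)"
    by (simp add: algebra_simps)
  finally have "p dvd pderiv (1 - pX ^ k)" by simp
  moreover have "pderiv (1 - pX ^ k) = smult (- of_nat k) (pX ^ (k - 1))"
    by (simp add: pX_power pderiv_diff pderiv_monom smult_monom flip: minus_monom)
  ultimately have "p dvd pX ^ (k - 1)"
    using k by (simp add: dvd_smult_iff)
  then have "p dvd pX ^ k"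
    using k by (metis Suc_diff_1 dvd_mult power_Suc)
  moreover have "p dvd 1 - pX ^ k" unfolding c by (rule dvd_triv_left)
  ultimately have "p dvd (1 - pX ^ k) + pX ^ k" by (intro dvd_add)
  then have "p dvd 1" by (simp only: diff_add_cancel)
  then show False using p by (simp add: prime_def prime_elem_def)
qed

lemma multiplicity_one_minus:
  assumes p: "prime p" and k: "k > 0"
  shows "multiplicity p (1 - pX ^ k) = (if p dvd 1 - pX ^ k then 1 else 0)"
proof -
  have "\<not> p ^ Suc 1 dvd 1 - pX ^ k"
    using not_sq_dvd[OF p k] by (simp add: numeral_2_eq_2)
  then show ?thesis
    using multiplicity_eqI[of p 1 "1 - pX ^ k"] by (simp add: not_dvd_imp_multiplicity_0)
qed

lemma multiplicity_cyc:
  assumes p: "prime p" and xs: "0 \<notin> set xs"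
  shows "multiplicity p (cyc xs) = length (filter (\<lambda>k. p dvd 1 - pX ^ k) xs)"
  using xs
proof (induction xs)
  case Nil
  then show ?case by (simp add: cyc_def)
next
  case (Cons k xs)
  have "multiplicity p (cyc (k # xs)) = multiplicity p (1 - pX ^ k) + multiplicity p (cyc xs)"
  proof -
    have eq: "cyc (k # xs) = (1 - pX ^ k) * cyc xs" by (simp add: cyc_def)
    have p': "prime_elem p" using p by simp
    have k: "1 - pX ^ k \<noteq> 0"
      using Cons.prems by (intro one_minus_pX_power_nz) auto
    have xs: "cyc xs \<noteq> 0" using Cons.prems by (intro cyc_nz) auto
    show ?thesis unfolding eq by (rule prime_elem_multiplicity_mult_distrib[OF p' k xs])
  qed
  then show ?case using Cons p by (simp add: multiplicity_one_minus)
qed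

lemma prime_dvd_one_minus:
  assumes p: "prime p"
  shows "(\<forall>k>0. \<not> p dvd 1 - pX ^ k) \<or> (\<exists>d>0. \<forall>k. p dvd 1 - pX ^ k \<longleftrightarrow> d dvd k)"
proof (cases "\<exists>k>0. p dvd 1 - pX ^ k")
  case True
  define d where "d = (LEAST k. k > 0 \<and> p dvd 1 - pX ^ k)"
  have d: "d > 0" "p dvd 1 - pX ^ d"
    using LeastI_ex[OF True] unfolding d_def by auto
  have least: "\<not> p dvd 1 - pX ^ k" if "0 < k" "k < d" for k
    using that not_less_Least unfolding d_def by blast
  have mult: "p dvd 1 - pX ^ (d * q)" for q
  proof -
    have "1 - pX ^ d dvd 1 - (pX ^ d) ^ q"
      unfolding one_diff_power_eq by (rule dvd_triv_left)
    then show ?thesis using d(2) unfolding power_mult by (rule dvd_trans[rotated])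
  qed
  have "p dvd 1 - pX ^ k \<longleftrightarrow> d dvd k" for k
  proof
    assume "d dvd k" then show "p dvd 1 - pX ^ k" using mult by (elim dvdE) (simp only:)
  next
    assume k: "p dvd 1 - pX ^ k"
    let ?r = "k mod d"
    have "pX ^ k = pX ^ (d * (k div d)) * pX ^ ?r"
      by (simp only: power_add[symmetric] mult_div_mod_eq)
    then have eq: "1 - pX ^ ?r = (1 - pX ^ k) - pX ^ ?r * (1 - pX ^ (d * (k div d)))"
      by (simp add: algebra_simps)
    have "p dvd 1 - pX ^ ?r"
      unfolding eq by (rule dvd_diff[OF k dvd_mult[OF mult]])
    then have "?r = 0" using least[of ?r] d(1) by auto
    then show "d dvd k" by auto
  qed
  then show ?thesis using d(1) by blast
next
  case False
  then show ?thesis by blast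
qed

lemma cyc_dvd:
  assumes xs: "0 \<notin> set xs" and ys: "0 \<notin> set ys"
    and count: "\<And>d. d > 0 \<Longrightarrow> length (filter ((dvd) d) xs) \<le> length (filter ((dvd) d) ys)"
  shows "cyc xs dvd cyc ys"
proof (rule multiplicity_le_imp_dvd)
  show "cyc xs \<noteq> 0" using xs by (rule cyc_nz)
  fix p :: "rat poly" assume p: "prime p"
  have "length (filter (\<lambda>k. p dvd 1 - pX ^ k) xs) \<le> length (filter (\<lambda>k. p dvd 1 - pX ^ k) ys)"
    using prime_dvd_one_minus[OF p]
  proof
    assume "\<forall>k>0. \<not> p dvd 1 - pX ^ k"
    then have "filter (\<lambda>k. p dvd 1 - pX ^ k) xs = []"
      using xs by (metis (no_types, lifting) filter_empty_conv gr0I)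
    then show ?thesis by simp
  next
    assume "\<exists>d>0. \<forall>k. p dvd 1 - pX ^ k \<longleftrightarrow> d dvd k"
    then obtain d where "d > 0" "\<And>k. p dvd 1 - pX ^ k \<longleftrightarrow> d dvd k" by blast
    then show ?thesis using count[of d] by simp
  qed
  then show "multiplicity p (cyc xs) \<le> multiplicity p (cyc ys)"
    using p xs ys by (simp add: multiplicity_cyc)
qed

lemma qpoch_cyc: "qpoch (pX ^ j) (pX ^ j) n = cyc (map ((*) j) [1..<Suc n])"
proof (induction n)
  case 0
  then show ?case by (simp add: qpoch_def cyc_def)
next
  case (Suc n)
  have "qpoch (pX ^ j) (pX ^ j) (Suc n) = qpoch (pX ^ j) (pX ^ j) n * (1 - pX ^ (j * Suc n))"
    by (simp add: qpoch_def power_add power_mult)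
  also have "\<dots> = cyc (map ((*) j) [1..<Suc n] @ [j * Suc n])"
    unfolding Suc cyc_append by (simp add: cyc_def)
  finally show ?case by simp
qed

lemma qpoch_cyc1: "qpoch pX pX n = cyc [1..<Suc n]"
proof -
  have "map ((*) 1) [1..<Suc n] = [1..<Suc n]" by (rule map_idI) simp
  then show ?thesis using qpoch_cyc[of 1 n] by (simp only: power_one_right)
qed

lemma count_multiples: "d > 0 \<Longrightarrow> length (filter ((dvd) d) [1..<Suc n]) = n div d"
  by (induction n) (auto simp: div_Suc dvd_eq_mod_eq_0)

lemma gauss_poly_mult:
  assumes "m \<le> n"
  shows "gauss_poly n m * (qpoch pX pX m * qpoch pX pX (n - m)) = qpoch pX pX n"
proof -
  have "qpoch pX pX m * qpoch pX pX (n - m) dvd qpoch pX pX n"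
    unfolding qpoch_cyc1 cyc_append[symmetric]
  proof (rule cyc_dvd)
    fix d :: nat assume d: "d > 0"
    have "(m div d + (n - m) div d) * d \<le> n"
      unfolding add_mult_distrib using assms
      using div_times_less_eq_dividend[of m d] div_times_less_eq_dividend[of "n - m" d] by linarith
    then have "m div d + (n - m) div d \<le> n div d"
      using d by (simp add: less_eq_div_iff_mult_less_eq)
    then show "length (filter ((dvd) d) ([1..<Suc m] @ [1..<Suc (n - m)]))
        \<le> length (filter ((dvd) d) [1..<Suc n])"
      unfolding filter_append length_append count_multiples[OF d] .
  qed auto
  then show ?thesis unfolding gauss_poly_def by (rule dvd_div_mult_self)
qed

lemma exponent_count:
  fixes M j d :: nat
  assumes M: "1 \<le> j" "j \<le> M" and d: "d > 0"
  shows "(M - j) div d + (M + j) div d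
    \<le> (2 * M - 1) div (d div gcd d j) + (if d dvd 2 * j then 1 else 0)"
proof -
  define s where "s = (M - j) div d + (M + j) div d"
  define e where "e = d div gcd d j"
  have e: "e > 0" "e \<le> d" unfolding e_def using d
    by (auto simp: div_greater_zero_iff gcd_le1_nat)
  have lo: "(M - j) div d * d \<le> M - j" "(M + j) div d * d \<le> M + j" by simp_all
  then have sd: "s * d \<le> 2 * M"
    unfolding s_def add_mult_distrib using M by linarith
  have se: "s * e \<le> s * d" using e by simp
  have "s \<le> (2 * M - 1) div e + (if d dvd 2 * j then 1 else 0)"
  proof (cases "d dvd 2 * j")
    case True
    have "s * e \<le> (2 * M - 1) + e" using sd se e by linarith
    then have "s \<le> (2 * M - 1 + e) div e" using e by (simp only: less_eq_div_iff_mult_less_eq)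
    also have "\<dots> = (2 * M - 1) div e + 1" using e(1) by (intro div_add_self2) simp
    finally show ?thesis using True by simp
  next
    case False
    have "s * d \<noteq> 2 * M"
    proof
      assume "s * d = 2 * M"
      then have "(M - j) div d * d = M - j" "(M + j) div d * d = M + j"
        using lo M unfolding s_def add_mult_distrib by linarith+
      then have "d dvd M - j" "d dvd M + j" by (metis dvd_triv_right)+
      then have "d dvd (M + j) - (M - j)" by (rule dvd_diff_nat[rotated])
      moreover have "(M + j) - (M - j) = 2 * j" using M by simp
      ultimately show False using False by simp
    qed
    then have "s * e \<le> 2 * M - 1" using sd se by linarith
    then show ?thesis using e False by (simp add: less_eq_div_iff_mult_less_eq)
  qed
  then show ?thesis unfolding s_def e_def .
qed

lemma dvd_mult_gcd_iff:
  fixes d j k :: nat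
  assumes "d > 0"
  shows "d dvd j * k \<longleftrightarrow> d div gcd d j dvd k"
proof -
  define g where "g = gcd d j"
  obtain d' j' where dj: "d = d' * g" "j = j' * g" "coprime d' j'"
    using gcd_coprime_exists[of d j] assms unfolding g_def by auto
  have g: "g > 0" using assms unfolding g_def by simp
  have "d dvd j * k \<longleftrightarrow> d' * g dvd (j' * k) * g" using dj by (simp add: ac_simps)
  also have "\<dots> \<longleftrightarrow> d' dvd j' * k" using g by simp
  also have "\<dots> \<longleftrightarrow> d' dvd k" using dj(3) by (simp add: coprime_dvd_mult_right_iff)
  also have "d' = d div gcd d j" using dj(1) g unfolding g_def[symmetric] by simp
  finally show ?thesis .
qed

lemma dissected_poly_dvd:
  assumes "1 \<le> j" "j \<le> M"
  shows "qpoch pX pX (2 * M) dvd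
    (1 - pX ^ (2 * j)) * qpoch (pX ^ j) (pX ^ j) (2 * M - 1) * gauss_poly (2 * M) (M - j)"
proof -
  let ?A = "(1 - pX ^ (2 * j)) * qpoch (pX ^ j) (pX ^ j) (2 * M - 1)"
  have A: "?A = cyc ((2 * j) # map ((*) j) [1..<Suc (2 * M - 1)])"
    unfolding qpoch_cyc by (simp add: cyc_def)
  have "qpoch pX pX (M - j) * qpoch pX pX (M + j) dvd ?A"
    unfolding qpoch_cyc1 cyc_append[symmetric] A
  proof (rule cyc_dvd)
    fix d :: nat assume d: "d > 0"
    have pos: "d div gcd d j > 0" using d by (simp add: div_greater_zero_iff gcd_le1_nat)
    have "length (filter ((dvd) d) (map ((*) j) [1..<Suc (2 * M - 1)]))
        = length (filter ((dvd) (d div gcd d j)) [1..<Suc (2 * M - 1)])"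
      unfolding filter_map length_map
      by (simp only: o_def dvd_mult_gcd_iff[OF d])
    also have "\<dots> = (2 * M - 1) div (d div gcd d j)" by (rule count_multiples[OF pos])
    finally show "length (filter ((dvd) d) ([1..<Suc (M - j)] @ [1..<Suc (M + j)]))
        \<le> length (filter ((dvd) d) ((2 * j) # map ((*) j) [1..<Suc (2 * M - 1)]))"
      unfolding filter_append length_append count_multiples[OF d]
      using exponent_count[OF assms d] by (simp del: upt_Suc split: if_splits)
  qed (use assms in auto)
  then obtain c where c: "?A = qpoch pX pX (M - j) * qpoch pX pX (M + j) * c" by (elim dvdE)
  have "gauss_poly (2 * M) (M - j) * (qpoch pX pX (M - j) * qpoch pX pX (M + j)) = qpoch pX pX (2 * M)"
    using gauss_poly_mult[of "M - j" "2 * M"] assms by (simp add: mult_2)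
  then have "?A * gauss_poly (2 * M) (M - j) = qpoch pX pX (2 * M) * c"
    unfolding c by (simp add: ac_simps)
  then show ?thesis by simp
qed

lemma fps_of_qpoch: "fps_of_poly (qpoch P Q n) = qpoch (fps_of_poly P) (fps_of_poly Q) n"
  by (simp add: qpoch_def fps_of_poly_prod fps_of_poly_diff fps_of_poly_mult fps_of_poly_power)

lemma qpoch_fps_X_nth_0: "fps_nth (qpoch fps_X fps_X n :: rat fps) 0 = 1"
  by (induction n) (simp_all add: qpoch_def)

lemma fps_of_gauss_poly:
  assumes "m \<le> n"
  shows "fps_of_poly (gauss_poly n m) =
    qpoch fps_X fps_X n / (qpoch fps_X fps_X m * qpoch fps_X fps_X (n - m))"
proof -
  have "fps_of_poly (gauss_poly n m * (qpoch pX pX m * qpoch pX pX (n - m)))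
      = fps_of_poly (qpoch pX pX n)"
    by (simp only: gauss_poly_mult[OF assms])
  then have eq: "fps_of_poly (gauss_poly n m) * (qpoch fps_X fps_X m * qpoch fps_X fps_X (n - m))
      = qpoch fps_X fps_X n"
    by (simp add: fps_of_poly_mult fps_of_qpoch fps_of_poly_fps_X)
  have "fps_nth (qpoch fps_X fps_X m * qpoch fps_X fps_X (n - m) :: rat fps) 0 = 1"
    by (simp add: qpoch_fps_X_nth_0)
  then have "(qpoch fps_X fps_X m * qpoch fps_X fps_X (n - m) :: rat fps) \<noteq> 0" by auto
  then show ?thesis using eq by (metis nonzero_mult_div_cancel_right)
qed

lemma fps_of_dissected_poly:
  assumes "1 \<le> j" "j \<le> M"
  shows "fps_of_poly (dissected_poly M r j) =
    fps_X ^ (r + ((M - j + 1) choose 2)) *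
    ((1 - fps_X ^ (2 * j)) * qpoch (fps_X ^ j) (fps_X ^ j) (2 * M - 1) / qpoch fps_X fps_X (2 * M)) *
    (qpoch fps_X fps_X (2 * M) / (qpoch fps_X fps_X (M - j) * qpoch fps_X fps_X (M + j)))"
proof -
  let ?A = "(1 - pX ^ (2 * j)) * qpoch (pX ^ j) (pX ^ j) (2 * M - 1)"
  let ?D = "qpoch fps_X fps_X (2 * M) :: rat fps"
  let ?a = "(1 - fps_X ^ (2 * j)) * qpoch (fps_X ^ j) (fps_X ^ j) (2 * M - 1) :: rat fps"
  let ?g = "fps_of_poly (gauss_poly (2 * M) (M - j))"
  have D0: "fps_nth ?D 0 \<noteq> 0" by (simp add: qpoch_fps_X_nth_0)
  have A: "fps_of_poly ?A = ?a"
    by (simp add: fps_of_poly_mult fps_of_poly_diff fps_of_poly_power fps_of_qpoch fps_of_poly_fps_X)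
  have g: "?g = ?D / (qpoch fps_X fps_X (M - j) * qpoch fps_X fps_X (M + j))"
    using fps_of_gauss_poly[of "M - j" "2 * M"] assms by (simp add: mult_2)
  let ?P = "(?A * gauss_poly (2 * M) (M - j)) div qpoch pX pX (2 * M)"
  have "?P * qpoch pX pX (2 * M) = ?A * gauss_poly (2 * M) (M - j)"
    using dissected_poly_dvd[OF assms] by (rule dvd_div_mult_self)
  then have "fps_of_poly (?P * qpoch pX pX (2 * M)) = fps_of_poly (?A * gauss_poly (2 * M) (M - j))"
    by (simp only:)
  then have "fps_of_poly ?P * ?D = ?a * ?g"
    by (simp only: A fps_of_poly_mult[of ?A] fps_of_poly_mult[of ?P] fps_of_qpoch fps_of_poly_fps_X)
  moreover have "?D \<noteq> 0" using D0 by auto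
  ultimately have "fps_of_poly ?P = ?a * ?g / ?D" by (metis nonzero_mult_div_cancel_right)
  also have "\<dots> = ?a / ?D * ?g"
    using D0 by (simp add: fps_divide_unit ac_simps)
  finally have "fps_of_poly ?P = ?a / ?D * ?g" .
  then show ?thesis
    unfolding dissected_poly_def fps_of_poly_mult[of "pX ^ _"] g[symmetric]
    by (simp add: fps_of_poly_power fps_of_poly_fps_X mult.assoc)
qed

end

theory Submission
  imports Defs
begin

text \<open>Removing a largest part shows that the generating function of the partitions in an
  \<open>m\<close> by \<open>N\<close> box is \<open>(q\<^bsup>N+1\<^esup>; q)\<^sub>m / (q; q)\<^sub>m\<close>. Expand the numerator for \<open>m = 2M\<close> by the
  \<open>q\<close>-binomial theorem. With \<open>c = A\<^sub>M a + r\<close>, the \<open>k\<close>-th term contributes to the coefficient of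
  \<open>q\<^bsup>MN-c\<^esup>\<close> the coefficient of \<open>q\<^bsup>(M-k)N\<^esup>\<close> in a power series independent of \<open>N\<close>, and nothing if
  \<open>k \<ge> M\<close>. Summing over \<open>N\<close> therefore gives the \<open>(M-k)\<close>-dissection of this series, and factors
  \<open>1 - z\<^bsup>jl\<^esup>\<close> can be pulled out of a \<open>j\<close>-dissection as \<open>1 - z\<^sup>l\<close>.\<close>

lemma qpoch_Suc: "qpoch x q (Suc n) = qpoch x q n * (1 - x * q ^ n)"
  by (simp add: qpoch_def)

lemma qpoch_Suc_left: "qpoch x q (Suc n) = (1 - x) * qpoch (x * q) q n"
  unfolding qpoch_def prod.lessThan_Suc_shift by (simp add: mult.assoc)

subsection \<open>Partitions in a box\<close>

lemma box_partitions_no_parts: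
  "box_partitions n 0 N = (if n = 0 then {{#}} else {})"
  "box_partitions n m 0 = (if n = 0 then {{#}} else {})"
proof -
  have "K = {#}" if "\<forall>k\<in>#K. 1 \<le> k \<and> k \<le> (0::nat)" for K
    using that by (cases K) auto
  then show "box_partitions n m 0 = (if n = 0 then {{#}} else {})"
    by (auto simp: box_partitions_def)
qed (auto simp: box_partitions_def)

lemma box_partitions_Suc_Suc:
  \<comment> \<open>Sort the partitions by whether a part \<open>Suc N\<close> occurs. If it does,
    one copy is removed, and the remaining parts may still equal \<open>Suc N\<close>.\<close>
  "box_partitions n (Suc m) (Suc N) =
    box_partitions n (Suc m) N \<union> add_mset (Suc N) ` box_partitions (n - int (Suc N)) m (Suc N)"
    (is "?L = ?A \<union> ?B")
proof (intro equalityI subsetI)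
  fix K assume K: "K \<in> ?L"
  show "K \<in> ?A \<union> ?B"
  proof (cases "Suc N \<in># K")
    case True
    then obtain K' where K': "K = add_mset (Suc N) K'" by (metis insert_DiffM)
    with K have "K' \<in> box_partitions (n - int (Suc N)) m (Suc N)"
      by (auto simp: box_partitions_def)
    with K' show ?thesis by blast
  next
    case False
    with K have "K \<in> ?A" by (auto simp: box_partitions_def le_Suc_eq)
    then show ?thesis ..
  qed
qed (auto simp: box_partitions_def)

lemma finite_box_partitions: "finite (box_partitions n m N)"
proof (induction m arbitrary: n N)
  case (Suc m)
  note outer = Suc.IH
  show ?case
  proof (induction N)
    case (Suc N)
    then show ?case using outer by (simp add: box_partitions_Suc_Suc)
  qed (simp add: box_partitions_no_parts)
qed (simp add: box_partitions_no_parts)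

lemma box_partition_count_Suc_Suc:
  "box_partition_count n (Suc m) (Suc N) =
    box_partition_count n (Suc m) N + box_partition_count (n - int (Suc N)) m (Suc N)"
proof -
  let ?B = "box_partitions (n - int (Suc N)) m (Suc N)"
  have disj: "box_partitions n (Suc m) N \<inter> add_mset (Suc N) ` ?B = {}"
  proof -
    have "Suc N \<notin># K" if "K \<in> box_partitions n (Suc m) N" for K
      using that Suc_n_not_le_n[of N] unfolding box_partitions_def by blast
    moreover have "Suc N \<in># K" if "K \<in> add_mset (Suc N) ` ?B" for K
      using that by (elim imageE) simp
    ultimately show ?thesis by blast
  qed
  have "card (box_partitions n (Suc m) (Suc N)) =
      card (box_partitions n (Suc m) N) + card (add_mset (Suc N) ` ?B)"
    unfolding box_partitions_Suc_Suc
    by (intro card_Un_disjoint finite_imageI finite_box_partitions disj)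
  also have "card (add_mset (Suc N) ` ?B) = card ?B"
    by (intro card_image inj_onI) simp
  finally show ?thesis unfolding box_partition_count_def .
qed

lemma box_partition_count_neg: "n < 0 \<Longrightarrow> box_partition_count n m N = 0"
proof -
  assume "n < 0"
  have "n \<ge> 0" if "K \<in> box_partitions n m N" for K
  proof -
    have "n = int (sum_mset K)" using that unfolding box_partitions_def by blast
    then show ?thesis by (simp only: of_nat_0_le_iff)
  qed
  with \<open>n < 0\<close> have "box_partitions n m N = {}" by (meson equals0I not_le)
  then show ?thesis by (simp add: box_partition_count_def)
qed

text \<open>This is the Gaussian polynomial with top \<open>N + m\<close> and bottom
  \<open>m\<close>, as a power series; \<open>box_fps_mult_qpoch\<close> gives its quotient
  form.\<close>

definition box_fps :: "nat \<Rightarrow> nat \<Rightarrow> rat fps"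
  where "box_fps m N = Abs_fps (\<lambda>n. of_nat (box_partition_count (int n) m N))"

text \<open>The count takes an integer and vanishes on negative ones, so the case
  \<open>n < c\<close> fits the same formula.\<close>

lemma fps_X_power_mult_box_fps_nth:
  "fps_nth (fps_X ^ c * box_fps m N) n = of_nat (box_partition_count (int n - int c) m N)"
  by (simp add: fps_X_power_mult_nth box_fps_def box_partition_count_neg of_nat_diff)

lemma box_fps_no_parts: "box_fps 0 N = 1" "box_fps m 0 = 1"
  by (simp_all add: fps_eq_iff box_fps_def box_partition_count_def box_partitions_no_parts)

lemma box_fps_Suc_Suc:
  "box_fps (Suc m) (Suc N) = box_fps (Suc m) N + fps_X ^ Suc N * box_fps m (Suc N)"
proof (rule fps_ext)
  fix n
  show "fps_nth (box_fps (Suc m) (Suc N)) n =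
      fps_nth (box_fps (Suc m) N + fps_X ^ Suc N * box_fps m (Suc N)) n"
    unfolding fps_add_nth fps_X_power_mult_box_fps_nth
    by (simp add: box_fps_def box_partition_count_Suc_Suc del: of_nat_Suc)
qed

lemma box_fps_mult_qpoch:
  "box_fps m N * qpoch fps_X fps_X m = qpoch (fps_X ^ Suc N) fps_X m"
proof (induction m arbitrary: N)
  case 0
  then show ?case by (simp add: box_fps_no_parts qpoch_def)
next
  case (Suc m)
  note outer = Suc.IH
  show ?case
  proof (induction N)
    case 0
    then show ?case by (simp add: box_fps_no_parts)
  next
    case (Suc N)
    let ?q = "fps_X :: rat fps"
    let ?P = "qpoch (?q ^ Suc (Suc N)) ?q m"
    have "box_fps (Suc m) (Suc N) * qpoch ?q ?q (Suc m)
        = box_fps (Suc m) N * qpoch ?q ?q (Suc m)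
          + ?q ^ Suc N * (1 - ?q * ?q ^ m) * (box_fps m (Suc N) * qpoch ?q ?q m)"
      by (simp only: box_fps_Suc_Suc qpoch_Suc algebra_simps)
    also have "\<dots> = (1 - ?q ^ Suc N) * ?P + ?q ^ Suc N * (1 - ?q * ?q ^ m) * ?P"
      unfolding Suc.IH outer qpoch_Suc_left[of "?q ^ Suc N"] by (simp only: power_Suc2)
    \<comment> \<open>Apart from the common factor \<open>?P\<close> this is
      \<open>(1 - q^(N+1)) + q^(N+1) (1 - q^(m+1)) = 1 - q^(N+m+2)\<close>.\<close>
    also have "\<dots> = qpoch (?q ^ Suc (Suc N)) ?q (Suc m)"
      unfolding qpoch_Suc by (simp add: algebra_simps)
    finally show ?case .
  qed
qed

subsection \<open>The q-binomial theorem\<close>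

lemma qpoch_pX_nz: "qpoch pX pX n \<noteq> 0"
  unfolding qpoch_cyc1 by (rule cyc_nz) simp

lemma gauss_poly_0_right [simp]: "gauss_poly n 0 = 1"
  using qpoch_pX_nz[of n] by (simp add: gauss_poly_def qpoch_def)

lemma gauss_poly_self [simp]: "gauss_poly n n = 1"
  using qpoch_pX_nz[of n] by (simp add: gauss_poly_def qpoch_def)

lemma degree_one_minus_pX_power: "degree (1 - pX ^ Suc k) = Suc k"
proof -
  have "degree (1 - pX ^ Suc k) = degree (pX ^ Suc k)"
    unfolding pX_power minus_add_distrib
    using degree_add_eq_right[of 1 "- monom (1::rat) (Suc k)"] by (simp add: degree_monom_eq)
  then show ?thesis by (simp add: pX_power degree_monom_eq del: power_Suc)
qed

lemma degree_qpoch_pX_less: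
  assumes "n < m" shows "degree (qpoch pX pX n) < degree (qpoch pX pX m)"
  using assms
proof (induction rule: less_Suc_induct)
  case (1 i)
  have "1 - pX * pX ^ i \<noteq> 0" using one_minus_pX_power_nz[of "Suc i"] by simp
  then show ?case
    unfolding qpoch_Suc using degree_one_minus_pX_power[of i] qpoch_pX_nz[of i]
    by (simp add: degree_mult_eq)
qed simp

text \<open>Here \<open>n - m\<close> truncates to 0, so the divisor is \<open>(q;q)_m\<close>,
  whose degree exceeds that of the dividend. Polynomial division thus yields the customary
  value.\<close>

lemma gauss_poly_eq_0: "n < m \<Longrightarrow> gauss_poly n m = 0"
  using degree_qpoch_pX_less[of n m] by (simp add: gauss_poly_def qpoch_def div_poly_less)

text \<open>The q-Pascal rule. Over a common denominator it reduces to
  \<open>(1 - q^(n-k)) + q^(n-k) (1 - q^(k+1)) = 1 - q^(n+1)\<close>.\<close>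

lemma gauss_poly_Suc_Suc:
  assumes "k \<le> n"
  shows "gauss_poly (Suc n) (Suc k) = gauss_poly n (Suc k) + pX ^ (n - k) * gauss_poly n k"
proof (cases "k = n")
  case True
  then show ?thesis by (simp add: gauss_poly_eq_0)
next
  case False
  with assms have "k < n" by simp
  \<comment> \<open>Since \<open>Suc l = n - k\<close>, the product \<open>?D\<close> below is a
    common denominator of all three Gaussian polynomials.\<close>
  then obtain l where n: "n = Suc (k + l)" using less_iff_Suc_add by blast
  let ?f = "qpoch pX pX"
  let ?D = "?f (Suc k) * ?f (Suc l)"
  have 1: "gauss_poly (Suc n) (Suc k) * ?D = ?f (Suc n)"
    using gauss_poly_mult[of "Suc k" "Suc n"] n by simp
  have 2: "gauss_poly n (Suc k) * (?f (Suc k) * ?f l) = ?f n"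
    using gauss_poly_mult[of "Suc k" n] n by simp
  have 3: "gauss_poly n k * (?f k * ?f (Suc l)) = ?f n"
    using gauss_poly_mult[of k n] n by (simp add: Suc_diff_le)
  have factor: "1 - pX * pX ^ l + pX ^ (n - k) * (1 - pX * pX ^ k) = 1 - pX * pX ^ n"
  proof -
    have "n - k = Suc l" "pX ^ n = pX ^ k * pX ^ l * pX" using n by (simp_all add: power_add)
    then show ?thesis by (simp only: power_Suc algebra_simps)
  qed
  have "(gauss_poly n (Suc k) + pX ^ (n - k) * gauss_poly n k) * ?D
      = (gauss_poly n (Suc k) * (?f (Suc k) * ?f l)) * (1 - pX * pX ^ l)
        + pX ^ (n - k) * (1 - pX * pX ^ k) * (gauss_poly n k * (?f k * ?f (Suc l)))"
    by (simp only: qpoch_Suc algebra_simps)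
  also have "\<dots> = ?f n * (1 - pX * pX ^ l + pX ^ (n - k) * (1 - pX * pX ^ k))"
    unfolding 2 3 by (simp only: algebra_simps)
  also have "\<dots> = gauss_poly (Suc n) (Suc k) * ?D"
    unfolding 1 factor by (rule qpoch_Suc[symmetric])
  finally have "gauss_poly (Suc n) (Suc k) * ?D
      = (gauss_poly n (Suc k) + pX ^ (n - k) * gauss_poly n k) * ?D" ..
  moreover have "?D \<noteq> 0" by (intro no_zero_divisors qpoch_pX_nz)
  ultimately show ?thesis by (simp only: mult_cancel_right) simp
qed

text \<open>Multiplying the sum by the new factor \<open>1 - x * pX ^ n\<close> recombines its
  coefficients by the q-Pascal rule. The application takes \<open>x = pX ^ Suc N\<close>.\<close>

theorem q_binomial:
  "qpoch x pX n = (\<Sum>k\<le>n. (-1) ^ k * pX ^ (k choose 2) * gauss_poly n k * x ^ k)"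
proof (induction n)
  case 0
  show ?case by (simp add: qpoch_def numeral_2_eq_2)
next
  case (Suc n)
  let ?t = "\<lambda>n k. (-1) ^ k * pX ^ (k choose 2) * gauss_poly n k * x ^ k"
  have step: "?t (Suc n) (Suc k) = ?t n (Suc k) - ?t n k * (x * pX ^ n)" if "k \<le> n" for k
  proof -
    have 1: "Suc k choose 2 = (k choose 2) + k" by (simp add: numeral_2_eq_2)
    have 2: "pX ^ n = pX ^ k * pX ^ (n - k)" using that by (simp only: flip: power_add) simp
    \<comment> \<open>A ring identity, to be read with \<open>e = (-1)^k\<close>,
      \<open>c = q^(k choose 2)\<close>, \<open>v = q^k\<close>, \<open>w = q^(n-k)\<close> and
      \<open>y = x^k\<close>.\<close>
    have "(- 1 * e) * (c * v) * (g1 + w * g0) * (x * y) =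
        (- 1 * e) * (c * v) * g1 * (x * y) - e * c * g0 * y * (x * (v * w))"
      for e c v w g0 g1 y :: "rat poly"
      by (simp add: algebra_simps)
    then show ?thesis
      unfolding gauss_poly_Suc_Suc[OF that] 1 2 power_add power_Suc .
  qed
  have split_0: "(\<Sum>k\<le>Suc n. ?t m k) = 1 + (\<Sum>k\<le>n. ?t m (Suc k))" for m
    unfolding sum.atMost_Suc_shift by (simp add: numeral_2_eq_2)
  have "(\<Sum>k\<le>n. ?t (Suc n) (Suc k)) = (\<Sum>k\<le>n. ?t n (Suc k) - ?t n k * (x * pX ^ n))"
    by (intro sum.cong refl step) simp
  then have "(\<Sum>k\<le>Suc n. ?t (Suc n) k) = (\<Sum>k\<le>Suc n. ?t n k) - (\<Sum>k\<le>n. ?t n k) * (x * pX ^ n)"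
    unfolding split_0 by (simp only: sum_subtractf sum_distrib_right add_diff_eq)
  \<comment> \<open>The extra term contains \<open>gauss_poly n (Suc n) = 0\<close>.\<close>
  also have "(\<Sum>k\<le>Suc n. ?t n k) = (\<Sum>k\<le>n. ?t n k)"
    by (simp add: gauss_poly_eq_0)
  finally show ?case
    unfolding qpoch_Suc Suc.IH by (simp only: right_diff_distrib mult_1_right)
qed

subsection \<open>Dissections of power series\<close>

text \<open>A counterpart of \<open>dissection\<close> for series: the terms to be dissected carry
  the factor \<open>1 / (q;q)_(2M)\<close> and need not be polynomials.\<close>

definition fps_dissect :: "nat \<Rightarrow> 'a::comm_ring_1 fps \<Rightarrow> 'a fps"
  where "fps_dissect s F = Abs_fps (\<lambda>n. fps_nth F (n * s))"

lemma fps_dissect_nth [simp]: "fps_nth (fps_dissect s F) n = fps_nth F (n * s)"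
  by (simp add: fps_dissect_def)

lemma fps_of_poly_dissection:
  assumes "s > 0"
  shows "fps_of_poly (dissection s P) = fps_dissect s (fps_of_poly P)"
proof (rule fps_ext)
  fix n
  have "degree P < n * s" if "degree P div s < n"
    using that assms by (simp add: div_less_iff_less_mult)
  then show "fps_nth (fps_of_poly (dissection s P)) n = fps_nth (fps_dissect s (fps_of_poly P)) n"
    by (auto simp: dissection_def coeff_sum coeff_eq_0 not_le)
qed

lemma fps_dissect_diff: "fps_dissect s (F - G) = fps_dissect s F - fps_dissect s G"
  by (simp add: fps_eq_iff)

lemma fps_dissect_X_power_mult:
  assumes "s > 0"
  shows "fps_dissect s (fps_X ^ (s * k) * F) = fps_X ^ k * fps_dissect s F"
proof (rule fps_ext)
  fix n
  have "n * s < s * k \<longleftrightarrow> n < k" "n * s - s * k = (n - k) * s"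
    using assms by (simp_all add: mult.commute[of s] diff_mult_distrib)
  then show "fps_nth (fps_dissect s (fps_X ^ (s * k) * F)) n = fps_nth (fps_X ^ k * fps_dissect s F) n"
    by (simp add: fps_X_power_mult_nth)
qed

lemma fps_dissect_mult_one_minus:
  assumes "s > 0"
  shows "fps_dissect s (F * (1 - fps_X ^ (s * k))) = fps_dissect s F * (1 - fps_X ^ k)"
proof -
  have "F * (1 - fps_X ^ l) = F - fps_X ^ l * F" for F :: "'a fps" and l
    by (simp add: algebra_simps)
  then show ?thesis
    by (simp only: fps_dissect_diff fps_dissect_X_power_mult[OF assms])
qed

text \<open>Applied from right to left, this moves a denominator \<open>(z;z)_n\<close> into a
  dissection, where it becomes \<open>(z^s;z^s)_n\<close>.\<close>

lemma fps_dissect_mult_qpoch: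
  assumes "s > 0"
  shows "fps_dissect s (F * qpoch (fps_X ^ s) (fps_X ^ s) n) = fps_dissect s F * qpoch fps_X fps_X n"
proof (induction n)
  case 0
  then show ?case by (simp add: qpoch_def)
next
  case (Suc n)
  have "fps_dissect s (F * qpoch (fps_X ^ s) (fps_X ^ s) (Suc n))
      = fps_dissect s (F * qpoch (fps_X ^ s) (fps_X ^ s) n * (1 - fps_X ^ (s * Suc n)))"
    by (simp add: qpoch_Suc power_add power_mult mult.assoc)
  then show ?case
    unfolding fps_dissect_mult_one_minus[OF assms] Suc.IH
    by (simp add: qpoch_Suc mult.assoc)
qed

subsection \<open>The generating function\<close>

lemma qpoch_X_mult_inverse: "qpoch fps_X fps_X n * inverse (qpoch fps_X fps_X n) = (1 :: rat fps)"
  by (simp add: inverse_mult_eq_1' qpoch_fps_X_nth_0)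

text \<open>The exponents \<open>k choose 2\<close> and \<open>(N+1) k\<close> from
  \<open>q_binomial\<close> are regrouped so that \<open>N\<close> enters only through the shift
  \<open>q^(N k)\<close>.\<close>

lemma box_fps_eq_sum:
  "box_fps m N = (\<Sum>k\<le>m. (-1) ^ k * fps_X ^ ((Suc k choose 2) + N * k) *
    (fps_of_poly (gauss_poly m k) * inverse (qpoch fps_X fps_X m)))"
proof -
  have "box_fps m N = box_fps m N * qpoch fps_X fps_X m * inverse (qpoch fps_X fps_X m)"
    by (simp add: mult.assoc qpoch_X_mult_inverse)
  also have "box_fps m N * qpoch fps_X fps_X m = fps_of_poly (qpoch (pX ^ Suc N) pX m)"
    by (simp add: box_fps_mult_qpoch fps_of_qpoch fps_of_poly_power fps_of_poly_fps_X del: power_Suc)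
  also have "\<dots> = (\<Sum>k\<le>m. (-1) ^ k * fps_X ^ ((Suc k choose 2) + N * k) *
      fps_of_poly (gauss_poly m k))"
    unfolding q_binomial fps_of_poly_sum
  proof (rule sum.cong[OF refl])
    fix k
    have P: "pX ^ ((Suc k choose 2) + N * k) = pX ^ (k choose 2) * (pX ^ Suc N) ^ k"
    proof -
      have "(Suc k choose 2) + N * k = (k choose 2) + Suc N * k"
        by (simp add: numeral_2_eq_2)
      then show ?thesis by (simp only: power_add power_mult)
    qed
    have "(-1) ^ k * pX ^ (k choose 2) * gauss_poly m k * (pX ^ Suc N) ^ k
        = (-1) ^ k * pX ^ ((Suc k choose 2) + N * k) * gauss_poly m k"
      unfolding P by (simp only: mult_ac)
    then show "fps_of_poly ((-1) ^ k * pX ^ (k choose 2) * gauss_poly m k * (pX ^ Suc N) ^ k)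
        = (-1) ^ k * fps_X ^ ((Suc k choose 2) + N * k) * fps_of_poly (gauss_poly m k)"
      by (simp only: fps_of_poly_mult fps_of_poly_power fps_of_poly_fps_X fps_of_poly_uminus
          fps_of_poly_1)
  qed
  finally show ?thesis by (simp add: sum_distrib_right mult.assoc)
qed

lemma neg_one_power_mult_nth: "fps_nth ((-1) ^ k * F) n = (-1) ^ k * fps_nth (F :: 'a::comm_ring_1 fps) n"
  by (cases "even k") auto

lemma box_partition_count_middle:
  assumes "M > 0"
  shows "rat_of_nat (box_partition_count (int M * int N - int c) (2 * M) N) =
    (\<Sum>j = 1..M. (-1) ^ (M - j) * fps_nth (fps_X ^ (c + (Suc (M - j) choose 2)) *
      (fps_of_poly (gauss_poly (2 * M) (M - j)) * inverse (qpoch fps_X fps_X (2 * M)))) (N * j))"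
proof -
  let ?h = "\<lambda>k. fps_of_poly (gauss_poly (2 * M) k) * inverse (qpoch fps_X fps_X (2 * M)) :: rat fps"
  let ?g = "\<lambda>k. (-1) ^ k * fps_nth (fps_X ^ (c + (Suc k choose 2)) * ?h k) (N * (M - k))"
  have "rat_of_nat (box_partition_count (int M * int N - int c) (2 * M) N)
      = fps_nth (fps_X ^ c * box_fps (2 * M) N) (M * N)"
    by (simp add: fps_X_power_mult_box_fps_nth)
  also have "fps_X ^ c * box_fps (2 * M) N
      = (\<Sum>k\<le>2 * M. (-1) ^ k * (fps_X ^ (c + (Suc k choose 2) + N * k) * ?h k))"
    unfolding box_fps_eq_sum sum_distrib_left by (simp add: power_add ac_simps)
  also have "fps_nth \<dots> (M * N)
      = (\<Sum>k\<le>2 * M. (-1) ^ k * fps_nth (fps_X ^ (c + (Suc k choose 2) + N * k) * ?h k) (M * N))"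
    by (simp add: fps_sum_nth neg_one_power_mult_nth)
  also have "\<dots> = (\<Sum>k<M. ?g k)"
  proof (rule sum.mono_neutral_cong_right)
    show "\<forall>k\<in>{..2 * M} - {..<M}.
        (-1) ^ k * fps_nth (fps_X ^ (c + (Suc k choose 2) + N * k) * ?h k) (M * N) = 0"
    proof
      fix k assume "k \<in> {..2 * M} - {..<M}"
      then have "M \<le> k" by simp
      \<comment> \<open>The binomial coefficient makes the inequality strict even for
        \<open>k = M\<close> and \<open>c = 0\<close>.\<close>
      then have "(Suc k choose 2) > 0" "M * N \<le> N * k" using assms by auto
      then have "M * N < c + (Suc k choose 2) + N * k" by linarith
      then show "(-1) ^ k *
          fps_nth (fps_X ^ (c + (Suc k choose 2) + N * k) * ?h k) (M * N) = 0"
        by (simp add: fps_X_power_mult_nth)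
    qed
    fix k assume "k \<in> {..<M}"
    \<comment> \<open>Removing the shift by \<open>N * k\<close> leaves the index
      \<open>N * (M - k)\<close>, hence \<open>N * j\<close> after the substitution
      \<open>j = M - k\<close>.\<close>
    then have "M * N = N * (M - k) + N * k" by (simp flip: distrib_left)
    then show "(-1) ^ k * fps_nth (fps_X ^ (c + (Suc k choose 2) + N * k) * ?h k) (M * N) = ?g k"
      by (simp add: fps_X_power_mult_nth)
  qed auto
  also have "\<dots> = (\<Sum>j = 1..M. ?g (M - j))"
    by (rule sum.reindex_bij_witness[of _ "\<lambda>j. M - j" "\<lambda>k. M - k"]) auto
  also have "\<dots> = (\<Sum>j = 1..M. (-1) ^ (M - j) *
      fps_nth (fps_X ^ (c + (Suc (M - j) choose 2)) * ?h (M - j)) (N * j))"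
    by (rule sum.cong) auto
  finally show ?thesis .
qed

text \<open>Clears the denominator of one summand: \<open>z^(A_M a)\<close> leaves the dissection as
  \<open>z^(A_M a / j)\<close>, while the denominator enters with \<open>z\<close> replaced by
  \<open>z^j\<close> and makes the argument a polynomial.\<close>

lemma fps_dissect_gauss_poly:
  assumes j: "1 \<le> j" "j \<le> M"
  shows "fps_dissect j (fps_X ^ (lcm_upto M * a + r + (Suc (M - j) choose 2)) *
      (fps_of_poly (gauss_poly (2 * M) (M - j)) * inverse (qpoch fps_X fps_X (2 * M)))) *
      ((1 - fps_X ^ 2) * qpoch fps_X fps_X (2 * M - 1))
    = fps_X ^ (lcm_upto M * a div j) * fps_of_poly (dissection j (dissected_poly M r j))"
proof -
  let ?Q = "inverse (qpoch fps_X fps_X (2 * M)) :: rat fps"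
  let ?h = "fps_of_poly (gauss_poly (2 * M) (M - j)) * ?Q"
  let ?e = "r + (Suc (M - j) choose 2)"
  have s: "j > 0" using j by simp
  \<comment> \<open>This divisibility is the purpose of \<open>A_M\<close>: one shift is a multiple
    of every \<open>j\<close> from 1 to \<open>M\<close>.\<close>
  have "j dvd lcm_upto M * a" unfolding lcm_upto_def using j by (intro dvd_mult2 dvd_Lcm) simp
  then obtain b where b: "lcm_upto M * a = j * b" by (elim dvdE)
  have "fps_dissect j (fps_X ^ (lcm_upto M * a + r + (Suc (M - j) choose 2)) * ?h)
      = fps_dissect j (fps_X ^ (j * b) * (fps_X ^ ?e * ?h))"
    unfolding b by (simp add: power_add mult.assoc)
  also have "\<dots> = fps_X ^ b * fps_dissect j (fps_X ^ ?e * ?h)"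
    by (rule fps_dissect_X_power_mult[OF s])
  also have "\<dots> * ((1 - fps_X ^ 2) * qpoch fps_X fps_X (2 * M - 1))
      = fps_X ^ b * fps_dissect j (fps_X ^ ?e * ?h * (1 - fps_X ^ (j * 2)) *
          qpoch (fps_X ^ j) (fps_X ^ j) (2 * M - 1))"
    unfolding fps_dissect_mult_qpoch[OF s] fps_dissect_mult_one_minus[OF s] by (simp add: mult.assoc)
  also have "fps_X ^ ?e * ?h * (1 - fps_X ^ (j * 2)) * qpoch (fps_X ^ j) (fps_X ^ j) (2 * M - 1)
      = fps_of_poly (dissected_poly M r j)"
  proof -
    have g: "fps_of_poly (gauss_poly (2 * M) (M - j)) = qpoch fps_X fps_X (2 * M) /
        (qpoch fps_X fps_X (M - j) * qpoch fps_X fps_X (M + j))"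
      using fps_of_gauss_poly[of "M - j" "2 * M"] j by (simp add: mult_2)
    have "x / qpoch fps_X fps_X (2 * M) = x * ?Q" for x :: "rat fps"
      by (simp add: fps_divide_unit qpoch_fps_X_nth_0)
    then show ?thesis
      unfolding fps_of_dissected_poly[OF j] g[symmetric] by (simp add: ac_simps)
  qed
  finally show ?thesis using b s by (simp add: fps_of_poly_dissection)
qed

theorem theorem2p2:
  fixes M a r :: nat
  assumes "M > 0"
  shows "Abs_fps (\<lambda>N. of_nat (box_partition_count
            (int M * int N - (int (lcm_upto M) * int a + int r)) (2 * M) N) :: rat)
       = fps_of_poly (Num_e M a r) / ((1 - fps_X ^ 2) * qpoch fps_X fps_X (2 * M - 1))"
    (is "?L = _ / ?D")
proof -
  let ?c = "lcm_upto M * a + r"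
  let ?F = "\<lambda>j. fps_X ^ (?c + (Suc (M - j) choose 2)) *
    (fps_of_poly (gauss_poly (2 * M) (M - j)) * inverse (qpoch fps_X fps_X (2 * M))) :: rat fps"
  have "?L = (\<Sum>j = 1..M. (-1) ^ (M - j) * fps_dissect j (?F j))"
  proof (rule fps_ext)
    fix N
    show "fps_nth ?L N = fps_nth (\<Sum>j = 1..M. (-1) ^ (M - j) * fps_dissect j (?F j)) N"
      using box_partition_count_middle[OF assms, of N ?c]
      by (simp add: fps_sum_nth neg_one_power_mult_nth)
  qed
  then have "?L * ?D = (\<Sum>j = 1..M. (-1) ^ (M - j) * (fps_dissect j (?F j) * ?D))"
    by (simp add: sum_distrib_right mult.assoc)
  also have "\<dots> = (\<Sum>j = 1..M. (-1) ^ (M - j) *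
      (fps_X ^ (lcm_upto M * a div j) * fps_of_poly (dissection j (dissected_poly M r j))))"
    by (intro sum.cong refl arg_cong2[where f = "(*)"] fps_dissect_gauss_poly) auto
  also have "\<dots> = fps_of_poly (Num_e M a r)"
    unfolding Num_e_def fps_of_poly_sum
    by (simp only: fps_of_poly_mult fps_of_poly_power fps_of_poly_fps_X fps_of_poly_uminus
        fps_of_poly_1 mult.assoc)
  finally have eq: "?L * ?D = fps_of_poly (Num_e M a r)" .
  \<comment> \<open>Constant term 1 makes \<open>?D\<close> nonzero, so dividing by it cancels the
    multiplication in \<open>eq\<close>.\<close>
  have "F \<noteq> 0" if "fps_nth F 0 = 1" for F :: "rat fps"
    using that by auto
  moreover have "fps_nth ?D 0 = 1" by (simp add: qpoch_fps_X_nth_0)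
  ultimately have "?D \<noteq> 0" by blast
  then show ?thesis
    unfolding eq[symmetric] by (rule nonzero_mult_div_cancel_right[symmetric])
qed

end
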